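(* Let $u\in\mathbb{Z}_{\ge 0}^m$ be a vector of counts with $n := \sum_{j=1}^m u_j\ge 1$, let $A\in\mathbb{Z}^{d\times m}$ have columns $a_1,\dots,a_m$, and let $b = Au$. The intersection of the irreducible components of the null cone for the action of the complex torus $(\mathbb{C}^\times)^d$ on $\mathbb{C}^m$ given by the matrix $nA$ with linearization $b$ is the coordinate subspace $$\langle e_j \mid n a_j\notin F_b(nA)\rangle .$$ In particular, if the all-ones vector lies in the row span of $A$, then the MLE given $u$ exists in the log-linear model $\mathcal{M}_A$ if and only if the intersection of the irreducible components of this null cone is $\{0\}$.
   Context: Torus action: for $B = (B_{ij}) \in \mathbb{Z}^{d\times m}$ and $b \in \mathbb{Z}^d$, the action of $(\mathbb{C}^\times)^d$ on $\mathbb{C}^m$ given by the matrix $B$ with linearization $b$ is $(\lambda\cdot v)_j = \lambda_1^{B_{1j}-b_1}\cdots\lambda_d^{B_{dj}-b_d}\, v_j$ for $\lambda\in(\mathbb{C}^\times)^d$, $v \in \mathbb{C}^m$. The null cone of the action is the set of unstable vectors, i.e. of all $v\in\mathbb{C}^m$ with $0$ in the Euclidean closure of the orbit of $v$. It is a Zariski closed subset of $\mathbb{C}^m$, and irreducible components are with respect to the Zariski topology. Notation: $e_1,\dots,e_m$ is the standard basis of $\mathbb{C}^m$ and $\langle\cdot\rangle$ denotes linear span. For a matrix $B$ with $m$ columns in $\mathbb{Z}^d$, $P(B)\subseteq\mathbb{R}^d$ is the convex hull of the columns of $B$; for $b\in P(B)$, $F_b(B)$ is the minimal face of the polytope $P(B)$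 containing $b$ (possibly $P(B)$ itself). (Here $b = Au \in P(nA)$.) Log-linear model: $\Delta_{m-1} = \{p\in\mathbb{R}^m : p_j\ge 0 \text{ for all } j,\ \sum_j p_j = 1\}$, and $\mathcal{M}_A = \{p\in\Delta_{m-1} : p_j > 0 \text{ for all } j,\ \log p \in \mathrm{rowspan}(A)\}$, where $\log$ is applied coordinatewise and the row span is over $\mathbb{R}$. An MLE given $u$ in $\mathcal{M}_A$ is a maximizer over $\mathcal{M}_A$ of the likelihood function $L_u(p) = p_1^{u_1}\cdots p_m^{u_m}$. *)

theory Defs
  imports "HOL-Analysis.Analysis"
begin

text \<open>
  Since the field of complex numbers is infinite, polynomials in finitely many variables may be
  identified with the functions they induce: the subalgebra generated by the coordinate functions.
\<close>

inductive_set polynomial_functions :: "(complex^'m \<Rightarrow> complex) set" where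
  const: "(\<lambda>_. c) \<in> polynomial_functions"
| coord: "(\<lambda>x. x $ j) \<in> polynomial_functions"
| add: "f \<in> polynomial_functions \<Longrightarrow> g \<in> polynomial_functions
    \<Longrightarrow> (\<lambda>x. f x + g x) \<in> polynomial_functions"
| mult: "f \<in> polynomial_functions \<Longrightarrow> g \<in> polynomial_functions
    \<Longrightarrow> (\<lambda>x. f x * g x) \<in> polynomial_functions"

definition zero_locus :: "(complex^'m \<Rightarrow> complex) set \<Rightarrow> (complex^'m) set" where
  "zero_locus P = {x. \<forall>f\<in>P. f x = 0}"

definition zariski :: "(complex^'m) topology" where
  "zariski = topology (\<lambda>U. \<exists>P\<subseteq>polynomial_functions. U = - zero_locus P)"

lemma istopology_zariski:
  "istopology (\<lambda>U :: (complex^'m) set. \<exists>P\<subseteq>polynomial_functions. U = - zero_locus P)"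
  unfolding istopology_def
proof (intro conjI allI impI)
  fix U V :: "(complex^'m) set"
  assume "\<exists>P\<subseteq>polynomial_functions. U = - zero_locus P"
    and "\<exists>P\<subseteq>polynomial_functions. V = - zero_locus P"
  then obtain P Q where P: "P \<subseteq> polynomial_functions" "U = - zero_locus P"
    and Q: "Q \<subseteq> polynomial_functions" "V = - zero_locus Q" by blast
  let ?R = "{\<lambda>x. f x * g x | f g. f \<in> P \<and> g \<in> Q}"
  have "?R \<subseteq> polynomial_functions"
    using P(1) Q(1) by (auto intro: polynomial_functions.mult)
  moreover have "U \<inter> V = - zero_locus ?R"
    unfolding P(2) Q(2) zero_locus_def by fastforce
  ultimately show "\<exists>P\<subseteq>polynomial_functions. U \<inter> V = - zero_locus P" by blast
next
  fix \<K> :: "(complex^'m) set set"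
  assume *: "\<forall>K\<in>\<K>. \<exists>P\<subseteq>polynomial_functions. K = - zero_locus P"
  then obtain P where P: "\<And>K. K \<in> \<K> \<Longrightarrow> P K \<subseteq> polynomial_functions \<and> K = - zero_locus (P K)"
    by metis
  have "\<Union>\<K> = - zero_locus (\<Union>K\<in>\<K>. P K)"
  proof -
    have "\<Union>\<K> = (\<Union>K\<in>\<K>. - zero_locus (P K))" using P by auto
    also have "\<dots> = - zero_locus (\<Union>K\<in>\<K>. P K)" by (auto simp: zero_locus_def)
    finally show ?thesis .
  qed
  moreover have "(\<Union>K\<in>\<K>. P K) \<subseteq> polynomial_functions" using P by blast
  ultimately show "\<exists>P\<subseteq>polynomial_functions. \<Union>\<K> = - zero_locus P" by blast
qed

lemma openin_zariski:
  "openin zariski U \<longleftrightarrow> (\<exists>P\<subseteq>polynomial_functions. U = - zero_locus P)"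
  by (simp add: zariski_def istopology_zariski)

lemma topspace_zariski [simp]: "topspace zariski = UNIV"
proof -
  have "openin zariski (UNIV :: (complex^'m) set)"
    unfolding openin_zariski
    by (rule exI[of _ "{\<lambda>_. 1}"]) (auto simp: zero_locus_def intro: polynomial_functions.const)
  then show ?thesis using openin_subset by blast
qed

lemma closedin_zariski:
  "closedin zariski S \<longleftrightarrow> (\<exists>P\<subseteq>polynomial_functions. S = zero_locus P)"
  by (simp add: closedin_def openin_zariski Compl_eq_Diff_UNIV[symmetric])

definition irreduciblein :: "'a topology \<Rightarrow> 'a set \<Rightarrow> bool" where
  "irreduciblein X S \<longleftrightarrow> S \<subseteq> topspace X \<and> S \<noteq> {} \<and>
    (\<forall>C D. closedin X C \<and> closedin X D \<and> S \<subseteq> C \<union> D \<longrightarrow> S \<subseteq> C \<or> S \<subseteq> D)"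

definition irreducible_components_of :: "'a topology \<Rightarrow> 'a set set" where
  "irreducible_components_of X =
    {S. irreduciblein X S \<and> (\<forall>T. irreduciblein X T \<and> S \<subseteq> T \<longrightarrow> T = S)}"

definition torus :: "(complex^'d) set" where
  "torus = {l. \<forall>i. l $ i \<noteq> 0}"

definition torus_action :: "int^'m^'d \<Rightarrow> int^'d \<Rightarrow> complex^'d \<Rightarrow> complex^'m \<Rightarrow> complex^'m" where
  "torus_action B b l v = (\<chi> j. (\<Prod>i\<in>UNIV. (l $ i) powi (B $ i $ j - b $ i)) * v $ j)"

definition torus_orbit :: "int^'m^'d \<Rightarrow> int^'d \<Rightarrow> complex^'m \<Rightarrow> (complex^'m) set" where
  "torus_orbit B b v = (\<lambda>l. torus_action B b l v) ` torus"

definition null_cone :: "int^'m^'d \<Rightarrow> int^'d \<Rightarrow> (complex^'m) set" where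
  "null_cone B b = {v. 0 \<in> closure (torus_orbit B b v)}"

definition real_vec :: "int^'n \<Rightarrow> real^'n" where
  "real_vec v = (\<chi> i. real_of_int (v $ i))"

definition real_matrix :: "int^'m^'d \<Rightarrow> real^'m^'d" where
  "real_matrix = map_matrix real_of_int"

definition column_polytope :: "int^'m^'d \<Rightarrow> (real^'d) set" where
  "column_polytope B = convex hull (columns (real_matrix B))"

text \<open>
  The faces of a convex set are closed under intersection, so the minimal face containing a
  point of the set is the intersection of all faces containing it.  The relation \<open>face_of\<close>
  includes the improper face.
\<close>

definition minimal_face :: "int^'m^'d \<Rightarrow> int^'d \<Rightarrow> (real^'d) set" where
  "minimal_face B b = \<Inter>{F. F face_of column_polytope B \<and> real_vec b \<in> F}"

definition row_span :: "int^'m^'d \<Rightarrow> (real^'m) set" where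
  "row_span A = span (rows (real_matrix A))"

definition prob_simplex :: "(real^'m) set" where
  "prob_simplex = {p. (\<forall>j. 0 \<le> p $ j) \<and> (\<Sum>j\<in>UNIV. p $ j) = 1}"

definition log_linear_model :: "int^'m^'d \<Rightarrow> (real^'m) set" where
  "log_linear_model A =
    {p \<in> prob_simplex. (\<forall>j. 0 < p $ j) \<and> (\<chi> j. ln (p $ j)) \<in> row_span A}"

definition likelihood :: "nat^'m \<Rightarrow> real^'m \<Rightarrow> real" where
  "likelihood u p = (\<Prod>j\<in>UNIV. (p $ j) ^ (u $ j))"

definition is_MLE :: "(real^'m) set \<Rightarrow> nat^'m \<Rightarrow> real^'m \<Rightarrow> bool" where
  "is_MLE M u p \<longleftrightarrow> is_arg_max (likelihood u) (\<lambda>q. q \<in> M) p"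

end

theory Submission
  imports Defs
begin

text \<open>
  By the Hilbert-Mumford criterion, the null cone is the union of the coordinate subspaces
  \<open>\<langle>e\<^sub>j | j \<in> S\<rangle>\<close> over all \<open>S\<close> for which \<open>b\<close> is outside the convex hull of the columns
  indexed by \<open>S\<close>.  Its irreducible components are those with \<open>S\<close> maximal, so \<open>e\<^sub>j\<close> lies in all of
  them iff adding \<open>j\<close> to such an \<open>S\<close> never captures \<open>b\<close>.  This happens iff no convex representation
  of \<open>b\<close> gives column \<open>j\<close> positive weight, that is, iff column \<open>j\<close> is not in the minimal face of \<open>b\<close>.
  So the intersection is zero iff \<open>b\<close> is a strictly positive convex combination of the columns.  A
  maximum likelihood estimate is such a combination by stationarity; conversely, a positive
  combination makes the superlevel sets of the concave log-likelihood compact.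
\<close>

section \<open>Convex weights, supports and minimal faces of a polytope\<close>

text \<open>Weights belong to indices rather than to points: columns may coincide, and both supports
  and positivity are tracked index by index.\<close>

definition convex_weights :: "('m::finite \<Rightarrow> 'a::real_vector) \<Rightarrow> 'a \<Rightarrow> ('m \<Rightarrow> real) set" where
  "convex_weights x b = {c. (\<forall>j. 0 \<le> c j) \<and> sum c UNIV = 1 \<and> (\<Sum>j\<in>UNIV. c j *\<^sub>R x j) = b}"

text \<open>The points represented by weights supported on \<open>S\<close> form a convex set
  containing the generators, so minimality of the hull yields the weights. The other direction is a
  convex sum over \<open>S\<close>.\<close>

lemma convex_hull_image_iff_weights:
  fixes x :: "'m::finite \<Rightarrow> 'a::real_vector"
  shows "b \<in> convex hull (x ` S) \<longleftrightarrow> (\<exists>c\<in>convex_weights x b. \<forall>j. j \<notin> S \<longrightarrow> c j = 0)"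
proof
  assume "\<exists>c\<in>convex_weights x b. \<forall>j. j \<notin> S \<longrightarrow> c j = 0"
  then obtain c where c: "\<And>j. 0 \<le> c j" "sum c UNIV = 1" "(\<Sum>j\<in>UNIV. c j *\<^sub>R x j) = b"
    and S: "\<And>j. j \<notin> S \<Longrightarrow> c j = 0"
    by (auto simp: convex_weights_def)
  have "sum c S = 1"
    using c(2) S by (subst sum.mono_neutral_left[of UNIV]) auto
  moreover have "(\<Sum>j\<in>S. c j *\<^sub>R x j) = b"
    unfolding c(3)[symmetric] using S by (intro sum.mono_neutral_left) auto
  moreover have "(\<Sum>j\<in>S. c j *\<^sub>R x j) \<in> convex hull (x ` S)"
    using c(1) \<open>sum c S = 1\<close> by (intro convex_sum convex_convex_hull hull_inc) auto
  ultimately show "b \<in> convex hull (x ` S)" by simp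
next
  let ?W = "{y. \<exists>c\<in>convex_weights x y. \<forall>j. j \<notin> S \<longrightarrow> c j = 0}"
  have "convex ?W"
  proof (rule convexI)
    fix y z and s t :: real
    assume y: "y \<in> ?W" and z: "z \<in> ?W" and st: "0 \<le> s" "0 \<le> t" "s + t = 1"
    obtain c where c: "c \<in> convex_weights x y" "\<forall>j. j \<notin> S \<longrightarrow> c j = 0" using y by auto
    obtain d where d: "d \<in> convex_weights x z" "\<forall>j. j \<notin> S \<longrightarrow> d j = 0" using z by auto
    have "0 \<le> s * c j + t * d j" for j
      using c(1) d(1) st by (simp add: convex_weights_def)
    moreover have "(\<Sum>j\<in>UNIV. s * c j + t * d j) = s * sum c UNIV + t * sum d UNIV"
      by (simp add: sum.distrib sum_distrib_left)
    moreover have "(\<Sum>j\<in>UNIV. (s * c j + t * d j) *\<^sub>R x j)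
        = s *\<^sub>R (\<Sum>j\<in>UNIV. c j *\<^sub>R x j) + t *\<^sub>R (\<Sum>j\<in>UNIV. d j *\<^sub>R x j)"
      by (simp add: sum.distrib scaleR_add_left scaleR_sum_right)
    ultimately have "(\<lambda>j. s * c j + t * d j) \<in> convex_weights x (s *\<^sub>R y + t *\<^sub>R z)"
      using c(1) d(1) st(3) by (simp add: convex_weights_def)
    moreover have "\<forall>j. j \<notin> S \<longrightarrow> s * c j + t * d j = 0"
      using c(2) d(2) by simp
    ultimately show "s *\<^sub>R y + t *\<^sub>R z \<in> ?W"
      by (intro CollectI bexI)
  qed
  moreover have "x ` S \<subseteq> ?W"
  proof safe
    fix k assume k: "k \<in> S"
    have "(\<lambda>j. if j = k then 1 else 0) \<in> convex_weights x (x k)"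
      by (auto simp: convex_weights_def if_distrib[of "\<lambda>t. t *\<^sub>R _"] cong: if_cong)
    then show "\<exists>c\<in>convex_weights x (x k). \<forall>j. j \<notin> S \<longrightarrow> c j = 0"
      using k by (intro bexI) auto
  qed
  ultimately have "convex hull (x ` S) \<subseteq> ?W"
    by (simp add: hull_minimal)
  moreover assume "b \<in> convex hull (x ` S)"
  ultimately show "\<exists>c\<in>convex_weights x b. \<forall>j. j \<notin> S \<longrightarrow> c j = 0" by blast
qed

lemma convex_hull_range_iff_weights:
  fixes x :: "'m::finite \<Rightarrow> 'a::real_vector"
  shows "b \<in> convex hull (range x) \<longleftrightarrow> convex_weights x b \<noteq> {}"
  by (auto simp: convex_hull_image_iff_weights)

text \<open>Unless \<open>x j = b\<close>, the point \<open>b\<close> lies strictly between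
  \<open>x j\<close> and the renormalised mean \<open>y\<close> of the remaining points. A face
  containing an inner point of a segment of the polytope contains both ends.\<close>

lemma face_of_contains_weighted_point:
  fixes x :: "'m::finite \<Rightarrow> 'a::real_vector"
  assumes F: "F face_of convex hull (range x)" and b: "b \<in> F"
    and c: "c \<in> convex_weights x b" and j: "0 < c j"
  shows "x j \<in> F"
proof (cases "x j = b")
  case False
  have c': "\<And>k. 0 \<le> c k" "sum c UNIV = 1" "(\<Sum>k\<in>UNIV. c k *\<^sub>R x k) = b"
    using c by (auto simp: convex_weights_def)
  have split: "c j + sum c (UNIV - {j}) = 1"
    "c j *\<^sub>R x j + (\<Sum>k\<in>UNIV - {j}. c k *\<^sub>R x k) = b"
    using c'(2,3) by (simp_all add: sum.remove[of UNIV j])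
  have "c j \<noteq> 1"
  proof
    assume 1: "c j = 1"
    then have "sum c (UNIV - {j}) = 0" using split(1) by simp
    then have "\<forall>k\<in>UNIV - {j}. c k = 0"
      using c'(1) by (subst (asm) sum_nonneg_eq_0_iff) auto
    then have "x j = b" using split(2) 1 by simp
    with False show False by simp
  qed
  moreover have "c j \<le> 1"
    using split(1) sum_nonneg[of "UNIV - {j}" c] c'(1) by simp
  ultimately have lt: "c j < 1" by simp
  define y where "y = (\<Sum>k\<in>UNIV - {j}. (c k / (1 - c j)) *\<^sub>R x k)"
  have y: "y \<in> convex hull (range x)"
    unfolding y_def
  proof (intro convex_sum convex_convex_hull hull_inc)
    show "(\<Sum>k\<in>UNIV - {j}. c k / (1 - c j)) = 1"
      using split(1) lt by (simp add: sum_divide_distrib[symmetric])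
  qed (use c'(1) lt in auto)
  have "(1 - c j) *\<^sub>R y = (\<Sum>k\<in>UNIV - {j}. c k *\<^sub>R x k)"
    using lt by (simp add: y_def scaleR_sum_right)
  then have b_eq: "b = (1 - c j) *\<^sub>R y + c j *\<^sub>R x j"
    using split(2) by (simp add: add.commute)
  have "y \<noteq> x j"
  proof
    assume "y = x j"
    then have "b = x j" using b_eq by (simp add: scaleR_left_diff_distrib)
    with False show False by simp
  qed
  then have "b \<in> open_segment y (x j)"
    unfolding in_segment using b_eq j lt by blast
  moreover have "x j \<in> convex hull (range x)" by (simp add: hull_inc)
  ultimately show ?thesis
    using face_ofD[OF F] b y by blast
qed (use b in simp)

text \<open>The point \<open>b\<close> is relatively interior to its minimal face, so the segment
  from \<open>x j\<close> to \<open>b\<close> can be prolonged beyond \<open>b\<close> inside the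
  face. Representing the prolonged end and solving for \<open>b\<close> puts positive weight on
  \<open>j\<close>.\<close>

lemma point_in_minimal_face_iff:
  fixes x :: "'m::finite \<Rightarrow> 'a::euclidean_space"
  assumes b: "b \<in> convex hull (range x)"
  shows "x j \<in> \<Inter>{F. F face_of convex hull (range x) \<and> b \<in> F}
    \<longleftrightarrow> (\<exists>c\<in>convex_weights x b. 0 < c j)" (is "_ \<in> \<Inter>?\<F> \<longleftrightarrow> _")
proof
  assume "\<exists>c\<in>convex_weights x b. 0 < c j"
  then show "x j \<in> \<Inter>?\<F>"
    by (blast intro: face_of_contains_weighted_point)
next
  let ?P = "convex hull (range x)" and ?F = "\<Inter>?\<F>"
  assume xj: "x j \<in> ?F"
  have P: "?P \<in> ?\<F>"
    using b by (simp add: face_of_refl)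
  have face: "?F face_of ?P"
    by (rule face_of_Inter) (use P in blast)+
  have poly: "polyhedron ?F"
    by (rule face_of_polyhedron_polyhedron[OF _ face])
      (simp add: polytope_convex_hull polytope_imp_polyhedron)
  have "b \<in> rel_interior ?F"
  proof -
    \<comment> \<open>A facet through \<open>b\<close> would be a face of the whole polytope
      containing \<open>b\<close>, hence would contain the minimal face of which it is a proper
      subset.\<close>
    have "b \<notin> G" if G: "G facet_of ?F" for G
    proof
      assume "b \<in> G"
      moreover have "G face_of ?P"
        using G face face_of_trans facet_of_def by blast
      ultimately have "?F \<subseteq> G" by blast
      then show False
        using G by (metis facet_of_irrefl facet_of_imp_subset subset_antisym)
    qed
    moreover have "b \<in> ?F" by blast
    ultimately show ?thesis
      unfolding rel_interior_of_polyhedron[OF poly] by blast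
  qed
  then obtain e where e: "e > 1" "(1 - e) *\<^sub>R x j + e *\<^sub>R b \<in> ?F"
    using xj convex_rel_interior_iff[of ?F b] face_of_imp_convex[OF face] by blast
  then have "(1 - e) *\<^sub>R x j + e *\<^sub>R b \<in> ?P" using P by blast
  then obtain c where "c \<in> convex_weights x ((1 - e) *\<^sub>R x j + e *\<^sub>R b)"
    by (auto simp: convex_hull_range_iff_weights)
  then have c: "\<And>k. 0 \<le> c k" "sum c UNIV = 1"
    "(\<Sum>k\<in>UNIV. c k *\<^sub>R x k) = (1 - e) *\<^sub>R x j + e *\<^sub>R b"
    by (auto simp: convex_weights_def)
  \<comment> \<open>Solving \<open>z = (1 - e) *\<^sub>R x j + e *\<^sub>R b\<close> for
    \<open>b\<close> gives \<open>z / e\<close> plus the fraction \<open>1 - 1 / e\<close> of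
    \<open>x j\<close>; here \<open>z\<close> has the weights \<open>c\<close>.\<close>
  define d where "d k = c k / e + (if k = j then 1 - 1 / e else 0)" for k
  have "d \<in> convex_weights x b"
  proof -
    have "0 \<le> d k" for k using c(1)[of k] e(1) by (auto simp: d_def)
    moreover have "sum d UNIV = 1"
      using c(2) by (simp add: d_def sum.distrib sum_divide_distrib[symmetric])
    moreover have "(\<Sum>k\<in>UNIV. d k *\<^sub>R x k) = b"
    proof -
      have "(\<Sum>k\<in>UNIV. d k *\<^sub>R x k)
          = (1 / e) *\<^sub>R (\<Sum>k\<in>UNIV. c k *\<^sub>R x k) + (1 - 1 / e) *\<^sub>R x j"
        by (simp add: d_def scaleR_add_left sum.distrib scaleR_sum_right
            if_distrib[of "\<lambda>t. t *\<^sub>R _"] cong: if_cong)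
      also have "\<dots> = b"
        unfolding c(3) using e(1)
        by (simp add: scaleR_add_right scaleR_left_diff_distrib scaleR_right_diff_distrib)
      finally show ?thesis .
    qed
    ultimately show ?thesis by (simp add: convex_weights_def)
  qed
  moreover have "0 < d j"
    unfolding d_def using c(1)[of j] e(1) by (simp add: add_nonneg_pos)
  ultimately show "\<exists>c\<in>convex_weights x b. 0 < c j" by blast
qed

text \<open>Weights supported on \<open>insert j S\<close> must charge \<open>j\<close> when
  \<open>S\<close> alone does not suffice. Conversely, among the weights positive at
  \<open>j\<close>, take those of smallest support and let \<open>S\<close> be that support without
  \<open>j\<close>; a representation over \<open>S\<close> would allow the support to shrink
  further.\<close>

lemma positive_weight_iff_essential:
  fixes x :: "'m::finite \<Rightarrow> 'a::real_vector"
  shows "(\<exists>c\<in>convex_weights x b. 0 < c j)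
    \<longleftrightarrow> (\<exists>S. b \<notin> convex hull (x ` S) \<and> b \<in> convex hull (x ` insert j S))"
proof
  assume "\<exists>S. b \<notin> convex hull (x ` S) \<and> b \<in> convex hull (x ` insert j S)"
  then obtain S where S: "b \<notin> convex hull (x ` S)" "b \<in> convex hull (x ` insert j S)" by blast
  obtain c where c: "c \<in> convex_weights x b" "\<And>k. k \<notin> insert j S \<Longrightarrow> c k = 0"
    using S(2) unfolding convex_hull_image_iff_weights by blast
  have "c j \<noteq> 0"
    using S(1) c unfolding convex_hull_image_iff_weights by (metis insert_iff)
  then have "0 < c j"
    using c(1) by (simp add: convex_weights_def less_le)
  with c(1) show "\<exists>c\<in>convex_weights x b. 0 < c j" by blast
next
  let ?Q = "\<lambda>c. c \<in> convex_weights x b \<and> 0 < c j"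
  assume "\<exists>c\<in>convex_weights x b. 0 < c j"
  then obtain c where Q: "?Q c" and min: "\<And>e. ?Q e \<Longrightarrow> card {k. c k \<noteq> 0} \<le> card {k. e k \<noteq> 0}"
    using ex_has_least_nat[of ?Q _ "\<lambda>c. card {k. c k \<noteq> 0}"] by blast
  have c: "\<And>k. 0 \<le> c k" "sum c UNIV = 1" "(\<Sum>k\<in>UNIV. c k *\<^sub>R x k) = b" "0 < c j"
    using Q by (auto simp: convex_weights_def)
  let ?S = "{k. c k \<noteq> 0} - {j}"
  have "b \<in> convex hull (x ` insert j ?S)"
    unfolding convex_hull_image_iff_weights using Q by auto
  moreover have "b \<notin> convex hull (x ` ?S)"
  proof
    \<comment> \<open>Moving from \<open>c\<close> away from \<open>d\<close> increases the weight of \<open>j\<close>; stop when another weight vanishes.\<close>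
    assume "b \<in> convex hull (x ` ?S)"
    then obtain d where "d \<in> convex_weights x b" and d0: "\<And>k. k \<notin> ?S \<Longrightarrow> d k = 0"
      unfolding convex_hull_image_iff_weights by blast
    then have d: "\<And>k. 0 \<le> d k" "sum d UNIV = 1" "(\<Sum>k\<in>UNIV. d k *\<^sub>R x k) = b"
      by (auto simp: convex_weights_def)
    have dj: "d j = 0" using d0 by simp
    let ?N = "{k. c k < d k}"
    have "?N \<noteq> {}"
    proof
      assume "?N = {}"
      then have "\<And>k. d k \<le> c k" by (metis (mono_tags) empty_Collect_eq not_less)
      then have "sum d UNIV < sum c UNIV"
        using c(4) dj by (intro sum_strict_mono_ex1 bexI[of _ j]) auto
      then show False using c(2) d(2) by simp
    qed
    \<comment> \<open>On the ray \<open>c + t * (c - d)\<close>, weight \<open>k\<close> with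
      \<open>c k < d k\<close> vanishes at \<open>t = r k\<close>. The smallest such time keeps all
      weights nonnegative.\<close>
    define r where "r k = c k / (d k - c k)" for k
    have "\<exists>k\<in>?N. \<forall>l\<in>?N. r k \<le> r l"
      using \<open>?N \<noteq> {}\<close> arg_min_if_finite[of ?N r] by (metis (mono_tags, lifting) finite not_less)
    then obtain k where k: "c k < d k" and kmin: "\<And>l. c l < d l \<Longrightarrow> r k \<le> r l" by auto
    have t: "0 \<le> r k" using c(1)[of k] k by (simp add: r_def)
    define e where "e l = c l + r k * (c l - d l)" for l
    have "0 \<le> e l" for l
    proof (cases "c l < d l")
      case True
      then have "r k * (d l - c l) \<le> c l"
        using kmin[OF True] by (simp add: r_def[of l] pos_le_divide_eq)
      then show ?thesis by (simp add: e_def algebra_simps)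
    next
      case False
      then show ?thesis using t c(1)[of l] by (simp add: e_def)
    qed
    moreover have "sum e UNIV = 1"
      using c(2) d(2) by (simp add: e_def sum.distrib sum_distrib_left[symmetric] sum_subtractf)
    moreover have "(\<Sum>l\<in>UNIV. e l *\<^sub>R x l) = b"
    proof -
      have "(\<Sum>l\<in>UNIV. e l *\<^sub>R x l) = (\<Sum>l\<in>UNIV. c l *\<^sub>R x l)
          + r k *\<^sub>R ((\<Sum>l\<in>UNIV. c l *\<^sub>R x l) - (\<Sum>l\<in>UNIV. d l *\<^sub>R x l))"
        by (simp add: e_def scaleR_add_left scaleR_diff_left scaleR_diff_right sum.distrib
            scaleR_sum_right sum_subtractf right_diff_distrib)
      then show ?thesis using c(3) d(3) by simp
    qed
    moreover have "0 < e j" using c(4) t by (simp add: e_def dj add_pos_nonneg)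
    ultimately have Qe: "?Q e" by (simp add: convex_weights_def)
    have "e k = 0" using k by (simp add: e_def r_def field_simps)
    moreover have "c k \<noteq> 0" using k d0[of k] by auto
    moreover have "e l = 0" if "c l = 0" for l
      using that d0[of l] by (simp add: e_def)
    ultimately have "{l. e l \<noteq> 0} \<subset> {l. c l \<noteq> 0}" by auto
    then have "card {l. e l \<noteq> 0} < card {l. c l \<noteq> 0}"
      by (intro psubset_card_mono) auto
    with min[OF Qe] show False by simp
  qed
  ultimately show "\<exists>S. b \<notin> convex hull (x ` S) \<and> b \<in> convex hull (x ` insert j S)" by blast
qed

section \<open>Coordinate subspaces in the Zariski topology\<close>

text \<open>Phrased through supports because membership in the null cone depends only on the support
  of a vector; \<open>coordinate_subspace_eq_span\<close> recovers the linear span.\<close>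

definition coordinate_subspace :: "'m set \<Rightarrow> (complex^'m) set" where
  "coordinate_subspace S = {v. {j. v $ j \<noteq> 0} \<subseteq> S}"

lemma in_coordinate_subspace_iff:
  "v \<in> coordinate_subspace S \<longleftrightarrow> (\<forall>j. j \<notin> S \<longrightarrow> v $ j = 0)"
  by (auto simp: coordinate_subspace_def)

text \<open>The indicator vector of \<open>S\<close> has support exactly \<open>S\<close>, so it
  alone tests the inclusion.\<close>

lemma coordinate_subspace_le_iff:
  "coordinate_subspace S \<subseteq> coordinate_subspace T \<longleftrightarrow> S \<subseteq> T"
proof
  assume *: "coordinate_subspace S \<subseteq> coordinate_subspace T"
  have "(\<chi> j. if j \<in> S then 1 else 0) \<in> coordinate_subspace S"
    by (auto simp: coordinate_subspace_def)
  with * have "(\<chi> j. if j \<in> S then 1 else 0) \<in> coordinate_subspace T" by blast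
  then show "S \<subseteq> T" by (auto simp: coordinate_subspace_def)
qed (auto simp: coordinate_subspace_def)

lemma coordinate_subspace_eq_iff: "coordinate_subspace S = coordinate_subspace T \<longleftrightarrow> S = T"
  using coordinate_subspace_le_iff[of S T] coordinate_subspace_le_iff[of T S] by blast

lemma coordinate_subspace_eq_0_iff: "coordinate_subspace S = {0} \<longleftrightarrow> S = {}"
proof -
  have "coordinate_subspace {} = {0}"
    by (auto simp: in_coordinate_subspace_iff vec_eq_iff)
  then show ?thesis
    by (metis coordinate_subspace_eq_iff)
qed

lemma coordinate_subspace_eq_span:
  "coordinate_subspace S = vec.span {axis j 1 | j. j \<in> S}"
proof
  show "vec.span {axis j 1 | j. j \<in> S} \<subseteq> coordinate_subspace S"
  proof (rule vec.span_minimal)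
    show "vec.subspace (coordinate_subspace S)"
      by (simp add: vec.subspace_def in_coordinate_subspace_iff)
  qed (auto simp: coordinate_subspace_def axis_def split: if_splits)
  show "coordinate_subspace S \<subseteq> vec.span {axis j 1 | j. j \<in> S}"
  proof
    fix v assume v: "v \<in> coordinate_subspace S"
    have "v = (\<Sum>j\<in>UNIV. v $ j *s axis j 1)" by (simp add: basis_expansion)
    also have "\<dots> \<in> vec.span {axis j 1 | j. j \<in> S}"
    proof (rule vec.span_sum)
      fix j
      show "v $ j *s axis j 1 \<in> vec.span {axis j 1 | j. j \<in> S}"
      proof (cases "v $ j = 0")
        case False
        then have "j \<in> S" using v by (auto simp: coordinate_subspace_def)
        then show ?thesis by (intro vec.span_scale vec.span_base) auto
      qed (simp add: vec.span_zero)
    qed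
    finally show "v \<in> vec.span {axis j 1 | j. j \<in> S}" .
  qed
qed

lemma closedin_zariski_coordinate_subspace: "closedin zariski (coordinate_subspace S)"
  unfolding closedin_zariski
proof (intro exI conjI)
  show "(\<lambda>j x. x $ j) ` (- S) \<subseteq> polynomial_functions"
    by (auto intro: polynomial_functions.coord)
  show "coordinate_subspace S = zero_locus ((\<lambda>j x. x $ j) ` (- S))"
    by (auto simp: coordinate_subspace_def zero_locus_def)
qed

text \<open>Reduces irreducibility to one variable, where a nonzero polynomial has only finitely
  many roots.\<close>

lemma polynomial_function_on_line:
  assumes "f \<in> polynomial_functions"
  shows "\<exists>p. \<forall>t. f (x + t *s y) = poly p t"
  using assms
proof induction
  case (const c)
  show ?case by (rule exI[of _ "[:c:]"]) simp
next
  case (coord j)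
  show ?case by (rule exI[of _ "[:x $ j, y $ j:]"]) simp
next
  case (add f g)
  then show ?case by (metis poly_add)
next
  case (mult f g)
  then show ?case by (metis poly_mult)
qed

text \<open>Two polynomials not vanishing identically on the subspace have a common non-zero on the line
  through their respective non-zeros.\<close>

lemma irreduciblein_zariski_coordinate_subspace:
  "irreduciblein zariski (coordinate_subspace S)"
  unfolding irreduciblein_def
proof (intro conjI allI impI)
  have "0 \<in> coordinate_subspace S" by (simp add: coordinate_subspace_def)
  then show "coordinate_subspace S \<noteq> {}" by blast
next
  fix C D :: "(complex^'a) set"
  assume *: "closedin zariski C \<and> closedin zariski D \<and> coordinate_subspace S \<subseteq> C \<union> D"
  then obtain P Q where P: "P \<subseteq> polynomial_functions" "C = zero_locus P"
    and Q: "Q \<subseteq> polynomial_functions" "D = zero_locus Q"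
    by (auto simp: closedin_zariski)
  show "coordinate_subspace S \<subseteq> C \<or> coordinate_subspace S \<subseteq> D"
  proof (rule ccontr)
    assume "\<not> ?thesis"
    then obtain x y where xy: "x \<in> coordinate_subspace S" "x \<notin> C"
      "y \<in> coordinate_subspace S" "y \<notin> D" by blast
    obtain f where f: "f \<in> P" "f x \<noteq> 0" using xy(2) by (auto simp: P(2) zero_locus_def)
    obtain g where g: "g \<in> Q" "g y \<noteq> 0" using xy(4) by (auto simp: Q(2) zero_locus_def)
    obtain p where p: "\<And>t. f (x + t *s (y - x)) = poly p t"
      using polynomial_function_on_line f(1) P(1) by (metis subsetD)
    obtain q where q: "\<And>t. g (x + t *s (y - x)) = poly q t"
      using polynomial_function_on_line g(1) Q(1) by (metis subsetD)
    have "poly p 0 \<noteq> 0" using p[of 0] f(2) by simp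
    moreover have "poly q 1 \<noteq> 0" using q[of 1] g(2) by simp
    ultimately have "p * q \<noteq> 0" by auto
    then have "finite {t. poly (p * q) t = 0}" by (rule poly_roots_finite)
    then obtain t where "poly (p * q) t \<noteq> 0"
      using infinite_UNIV_char_0 by (metis (mono_tags, lifting) UNIV_eq_I mem_Collect_eq)
    then have t: "f (x + t *s (y - x)) \<noteq> 0" "g (x + t *s (y - x)) \<noteq> 0"
      unfolding p q by auto
    have "x + t *s (y - x) \<in> coordinate_subspace S"
      using xy(1,3) by (simp add: in_coordinate_subspace_iff)
    with * t f(1) g(1) show False unfolding P(2) Q(2) zero_locus_def by blast
  qed
qed simp

section \<open>Irreducible components of arrangements of coordinate subspaces\<close>

text \<open>Induction extends the two-set condition to finite covers; the empty cover is excluded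
  because irreducible sets are nonempty.\<close>

lemma irreduciblein_subset_UN:
  assumes "finite I" "irreduciblein X S" "\<And>i. i \<in> I \<Longrightarrow> closedin X (C i)" "S \<subseteq> (\<Union>i\<in>I. C i)"
  shows "\<exists>i\<in>I. S \<subseteq> C i"
  using assms(1,3,4)
proof (induction I)
  case empty
  then show ?case using assms(2) by (auto simp: irreduciblein_def)
next
  case (insert i I)
  have "closedin X (\<Union>i\<in>I. C i)"
    using insert by (intro closedin_Union) auto
  moreover have "closedin X (C i)" "S \<subseteq> C i \<union> (\<Union>i\<in>I. C i)" using insert by auto
  ultimately have "S \<subseteq> C i \<or> S \<subseteq> (\<Union>i\<in>I. C i)"
    using assms(2) unfolding irreduciblein_def by blast
  then show ?case using insert by blast
qed

text \<open>Closed sets of the subspace are traces on \<open>N\<close>, and for \<open>S\<close>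
  inside \<open>N\<close> lying in a set is the same as lying in its trace. Components of the null
  cone can thus be computed with closed sets of the ambient space.\<close>

lemma irreduciblein_subtopology:
  assumes "N \<subseteq> topspace X"
  shows "irreduciblein (subtopology X N) S \<longleftrightarrow> S \<subseteq> N \<and> irreduciblein X S"
proof safe
  assume S: "irreduciblein (subtopology X N) S"
  then show SN: "x \<in> N" if "x \<in> S" for x
    using that by (auto simp: irreduciblein_def)
  show "irreduciblein X S"
    unfolding irreduciblein_def
  proof (intro conjI allI impI)
    fix C D assume "closedin X C \<and> closedin X D \<and> S \<subseteq> C \<union> D"
    then have "closedin (subtopology X N) (C \<inter> N)" "closedin (subtopology X N) (D \<inter> N)"
      "S \<subseteq> C \<inter> N \<union> D \<inter> N"
      using SN by (auto simp: closedin_subtopology)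
    then show "S \<subseteq> C \<or> S \<subseteq> D"
      using S unfolding irreduciblein_def by (meson le_inf_iff)
  qed (use S in \<open>auto simp: irreduciblein_def\<close>)
next
  assume S: "S \<subseteq> N" "irreduciblein X S"
  show "irreduciblein (subtopology X N) S"
    unfolding irreduciblein_def
  proof (intro conjI allI impI)
    fix C D
    assume *: "closedin (subtopology X N) C \<and> closedin (subtopology X N) D \<and> S \<subseteq> C \<union> D"
    then obtain C' D' where C': "closedin X C'" "C = C' \<inter> N" and D': "closedin X D'" "D = D' \<inter> N"
      by (auto simp: closedin_subtopology)
    then have "S \<subseteq> C' \<or> S \<subseteq> D'"
      using S(2) * unfolding irreduciblein_def by blast
    then show "S \<subseteq> C \<or> S \<subseteq> D" using S(1) C' D' by blast
  qed (use S in \<open>auto simp: irreduciblein_def\<close>)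
qed

text \<open>An irreducible subset of the union lies in one of the finitely many closed subspaces,
  and each of these is itself irreducible. Maximal irreducible sets are therefore the maximal
  subspaces, and inclusion of subspaces mirrors inclusion of index sets.\<close>

lemma irreducible_components_of_coordinate_arrangement:
  fixes \<U> :: "'m::finite set set"
  shows "irreducible_components_of (subtopology zariski (\<Union>S\<in>\<U>. coordinate_subspace S))
    = coordinate_subspace ` {S \<in> \<U>. \<forall>T\<in>\<U>. S \<subseteq> T \<longrightarrow> T = S}" (is "?C = ?M")
proof -
  let ?N = "\<Union>S\<in>\<U>. coordinate_subspace S"
  have irr: "irreduciblein (subtopology zariski ?N) X \<longleftrightarrow> X \<subseteq> ?N \<and> irreduciblein zariski X" for X
    by (rule irreduciblein_subtopology) simp
  have cover: "\<exists>S\<in>\<U>. X \<subseteq> coordinate_subspace S" if "X \<subseteq> ?N" "irreduciblein zariski X" for X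
    by (rule irreduciblein_subset_UN[OF finite that(2) closedin_zariski_coordinate_subspace that(1)])
  have mem: "irreduciblein (subtopology zariski ?N) (coordinate_subspace S)" if "S \<in> \<U>" for S
    using that irreduciblein_zariski_coordinate_subspace by (auto simp: irr)
  show ?thesis
  proof
    show "?C \<subseteq> ?M"
    proof
      fix X assume X: "X \<in> ?C"
      then have "X \<subseteq> ?N" "irreduciblein zariski X"
        by (auto simp: irreducible_components_of_def irr)
      then obtain S where S: "S \<in> \<U>" "X \<subseteq> coordinate_subspace S"
        using cover by blast
      then have eq: "X = coordinate_subspace S"
        using X mem by (auto simp: irreducible_components_of_def)
      have "T = S" if "T \<in> \<U>" "S \<subseteq> T" for T
      proof -
        have "coordinate_subspace T = coordinate_subspace S"
          using X mem[OF that(1)] that(2) coordinate_subspace_le_iff[of S T]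
          unfolding irreducible_components_of_def eq by blast
        then show ?thesis by (simp add: coordinate_subspace_eq_iff)
      qed
      with S eq show "X \<in> ?M" by auto
    qed
    show "?M \<subseteq> ?C"
    proof
      fix X assume "X \<in> ?M"
      then obtain S where S: "X = coordinate_subspace S" "S \<in> \<U>"
        and max: "\<And>T. T \<in> \<U> \<Longrightarrow> S \<subseteq> T \<Longrightarrow> T = S" by auto
      have "Y = X" if Y: "irreduciblein (subtopology zariski ?N) Y" "X \<subseteq> Y" for Y
      proof -
        obtain T where T: "T \<in> \<U>" "Y \<subseteq> coordinate_subspace T" using Y cover irr by blast
        then have "S \<subseteq> T" using S(1) Y(2) coordinate_subspace_le_iff by (metis subset_trans)
        with T max Y(2) S(1) show ?thesis by blast
      qed
      then show "X \<in> ?C"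
        using mem[OF S(2)] S(1) by (auto simp: irreducible_components_of_def)
    qed
  qed
qed

text \<open>If \<open>j\<close> lies in all maximal members, then any \<open>S\<close> extends to a
  maximal one that also contains \<open>insert j S\<close>, and \<open>\<U>\<close> is closed under
  subsets. Conversely, a maximal member to which \<open>j\<close> may be added already contains
  \<open>j\<close>.\<close>

lemma Inter_irreducible_components_of_coordinate_arrangement:
  fixes \<U> :: "'m::finite set set"
  assumes "{} \<in> \<U>" and down: "\<And>S T. T \<in> \<U> \<Longrightarrow> S \<subseteq> T \<Longrightarrow> S \<in> \<U>"
  shows "\<Inter>(irreducible_components_of (subtopology zariski (\<Union>S\<in>\<U>. coordinate_subspace S)))
    = coordinate_subspace {j. \<forall>S\<in>\<U>. insert j S \<in> \<U>}"
proof -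
  let ?M = "{S \<in> \<U>. \<forall>T\<in>\<U>. S \<subseteq> T \<longrightarrow> T = S}"
  have max: "\<exists>M\<in>?M. S \<subseteq> M" if "S \<in> \<U>" for S
    using finite_has_maximal2[of \<U> S] that by auto
  have "(\<Inter>(coordinate_subspace ` ?M)) = coordinate_subspace (\<Inter>?M)"
    by (auto simp: coordinate_subspace_def)
  moreover have "\<Inter>?M = {j. \<forall>S\<in>\<U>. insert j S \<in> \<U>}"
  proof safe
    fix j S assume j: "j \<in> \<Inter>?M" and S: "S \<in> \<U>"
    obtain M where M: "M \<in> ?M" "S \<subseteq> M" using max[OF S] by blast
    then have "insert j S \<subseteq> M" "M \<in> \<U>" using j by auto
    then show "insert j S \<in> \<U>" using down by blast
  next
    fix j M assume "\<forall>S\<in>\<U>. insert j S \<in> \<U>" "M \<in> \<U>" "\<forall>T\<in>\<U>. M \<subseteq> T \<longrightarrow> T = M"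
    then show "j \<in> M" by (metis insertI1 subset_insertI)
  qed
  ultimately show ?thesis
    by (simp add: irreducible_components_of_coordinate_arrangement)
qed

section \<open>Torus orbits and the null cone\<close>

lemma real_vec_nth [simp]: "real_vec v $ i = real_of_int (v $ i)"
  by (simp add: real_vec_def)

lemma column_real_matrix_nth [simp]: "column j (real_matrix B) $ i = real_of_int (B $ i $ j)"
  by (simp add: column_def real_matrix_def map_matrix_def)

lemma torus_action_nth_eq_0_iff:
  assumes "l \<in> torus"
  shows "torus_action B b l v $ j = 0 \<longleftrightarrow> v $ j = 0"
  using assms by (simp add: torus_action_def torus_def)

text \<open>In logarithms of absolute values the action becomes translation by the pairing with the
  weight "column minus \<open>b\<close>", so linear relations among weights turn into invariants of
  orbits.\<close>

lemma ln_norm_torus_action: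
  assumes l: "l \<in> torus" and v: "v $ j \<noteq> 0"
  shows "ln (norm (torus_action B b l v $ j))
    = (column j (real_matrix B) - real_vec b) \<bullet> (\<chi> i. ln (norm (l $ i))) + ln (norm (v $ j))"
proof -
  have l0: "l $ i \<noteq> 0" for i using l by (simp add: torus_def)
  have "ln (norm (torus_action B b l v $ j))
      = ln (\<Prod>i\<in>UNIV. norm (l $ i) powi (B $ i $ j - b $ i)) + ln (norm (v $ j))"
    using l0 v
    by (simp add: torus_action_def norm_mult prod_norm[symmetric] norm_power_int ln_mult)
  also have "ln (\<Prod>i\<in>UNIV. norm (l $ i) powi (B $ i $ j - b $ i))
      = (\<Sum>i\<in>UNIV. ln (norm (l $ i) powi (B $ i $ j - b $ i)))"
    using l0 by (intro ln_prod) auto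
  also have "\<dots> = (\<Sum>i\<in>UNIV. real_of_int (B $ i $ j - b $ i) * ln (norm (l $ i)))"
    using l0 by (intro sum.cong refl) (simp add: powr_real_of_int'[symmetric] ln_powr)
  finally show ?thesis by (simp add: inner_vec_def)
qed

text \<open>Hilbert-Mumford criterion.  A convex representation of \<open>b\<close> by the weights of \<open>v\<close> gives a monomial
  in the absolute values of the coordinates that is constant and non-zero on the orbit; conversely a
  hyperplane separating \<open>b\<close> from the weights gives a real one-parameter subgroup driving \<open>v\<close> to \<open>0\<close>.\<close>

lemma in_null_cone_iff:
  fixes B :: "int^'m^'d"
  shows "v \<in> null_cone B b \<longleftrightarrow>
    real_vec b \<notin> convex hull ((\<lambda>j. column j (real_matrix B)) ` {j. v $ j \<noteq> 0})"
proof
  let ?x = "\<lambda>j. column j (real_matrix B)"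
  assume v: "v \<in> null_cone B b"
  show "real_vec b \<notin> convex hull (?x ` {j. v $ j \<noteq> 0})"
  proof
    assume "real_vec b \<in> convex hull (?x ` {j. v $ j \<noteq> 0})"
    then obtain c where cw: "c \<in> convex_weights ?x (real_vec b)"
      and c0: "\<And>j. v $ j = 0 \<Longrightarrow> c j = 0"
      unfolding convex_hull_image_iff_weights by blast
    have c: "\<And>j. 0 \<le> c j" "sum c UNIV = 1" "(\<Sum>j\<in>UNIV. c j *\<^sub>R ?x j) = real_vec b"
      using cw by (auto simp: convex_weights_def)
    \<comment> \<open>\<open>K\<close> is the logarithm of the invariant monomial at
      \<open>v\<close>. As the exponents \<open>c\<close> sum to 1, it bounds
      \<open>ln (norm y)\<close> from below on the orbit, so no orbit point has norm below
      \<open>exp K\<close>. Vanishing coordinates do not disturb this, since \<open>c\<close> is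
      zero there.\<close>
    define K where "K = (\<Sum>j\<in>UNIV. c j * ln (norm (v $ j)))"
    obtain y where "y \<in> torus_orbit B b v" and y: "norm y < exp K"
      using v closure_approachable[of 0 "torus_orbit B b v"]
      unfolding null_cone_def by (metis exp_gt_zero dist_0_norm dist_commute mem_Collect_eq)
    then obtain l where l: "l \<in> torus" and yl: "y = torus_action B b l v"
      by (auto simp: torus_orbit_def)
    let ?w = "\<chi> i. ln (norm (l $ i))"
    have term_eq: "c j * ln (norm (y $ j))
        = (c j *\<^sub>R (?x j - real_vec b)) \<bullet> ?w + c j * ln (norm (v $ j))" for j
    proof (cases "v $ j = 0")
      case False
      then show ?thesis
        unfolding yl ln_norm_torus_action[OF l False] by (simp add: distrib_left)
    qed (simp add: c0)
    have "(\<Sum>j\<in>UNIV. c j *\<^sub>R (?x j - real_vec b)) = 0"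
      using c(2,3) by (simp add: scaleR_diff_right sum_subtractf scaleR_sum_left[symmetric])
    then have eq: "(\<Sum>j\<in>UNIV. c j * ln (norm (y $ j))) = K"
      unfolding term_eq K_def by (simp add: sum.distrib inner_sum_left[symmetric] del: inner_scaleR_left)
    have "c j * ln (norm (y $ j)) \<le> c j * ln (norm y)" for j
    proof (cases "v $ j = 0")
      case False
      then have "y $ j \<noteq> 0" using l by (simp add: yl torus_action_nth_eq_0_iff)
      then have "ln (norm (y $ j)) \<le> ln (norm y)"
        by (subst ln_le_cancel_iff) (auto simp: Finite_Cartesian_Product.norm_nth_le)
      then show ?thesis using c(1) by (rule mult_left_mono)
    qed (simp add: c0)
    then have "K \<le> (\<Sum>j\<in>UNIV. c j * ln (norm y))"
      unfolding eq[symmetric] by (rule sum_mono)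
    also have "\<dots> = ln (norm y)"
      using c(2) by (simp add: sum_distrib_right[symmetric])
    finally have K: "K \<le> ln (norm y)" .
    have "y \<noteq> 0"
    proof
      assume "y = 0"
      then have "v $ j = 0" for j using torus_action_nth_eq_0_iff[OF l] yl by (metis zero_index)
      then show False using c0 c(2) by simp
    qed
    with K have "exp K \<le> norm y" by (simp add: ln_ge_iff)
    with y show False by simp
  qed
next
  let ?x = "\<lambda>j. column j (real_matrix B)"
  let ?H = "convex hull (?x ` {j. v $ j \<noteq> 0})"
  assume "real_vec b \<notin> ?H"
  moreover have "closed ?H"
    by (intro compact_imp_closed finite_imp_compact_convex_hull) simp
  ultimately obtain w \<beta> where w: "w \<bullet> real_vec b < \<beta>" "\<And>y. y \<in> ?H \<Longrightarrow> w \<bullet> y > \<beta>"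
    using separating_hyperplane_closed_point[of ?H "real_vec b"] by (auto simp: convex_convex_hull)
  define \<delta> where "\<delta> j = w \<bullet> (?x j - real_vec b)" for j
  have \<delta>: "0 < \<delta> j" if "v $ j \<noteq> 0" for j
  proof -
    have "?x j \<in> ?H" using that by (intro hull_inc) auto
    then show ?thesis using w by (fastforce simp: \<delta>_def inner_diff_right)
  qed
  \<comment> \<open>The one-parameter subgroup for \<open>- w\<close> at integer times: coordinate
    \<open>j\<close> is scaled by \<open>exp (- (real k * \<delta> j))\<close>, with
    \<open>\<delta> j\<close> positive on the support of \<open>v\<close>.\<close>
  define l :: "nat \<Rightarrow> complex^'d" where "l k = (\<chi> i. of_real (exp (- (real k * w $ i))))" for k
  have act: "torus_action B b (l k) v $ j = of_real (exp (- (real k * \<delta> j))) * v $ j" for j k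
  proof -
    have "(\<Prod>i\<in>UNIV. (l k $ i) powi (B $ i $ j - b $ i))
        = of_real (exp (\<Sum>i\<in>UNIV. of_int (B $ i $ j - b $ i) * (- (real k * w $ i))))"
      by (simp only: l_def vec_lambda_beta of_real_power_int[symmetric] exp_power_int
          of_real_prod[symmetric] exp_sum[OF finite])
    also have "(\<Sum>i\<in>UNIV. of_int (B $ i $ j - b $ i) * (- (real k * w $ i))) = - (real k * \<delta> j)"
      by (simp add: \<delta>_def inner_vec_def sum_distrib_left sum_negf[symmetric] algebra_simps)
    finally show ?thesis by (simp add: torus_action_def)
  qed
  have "(\<lambda>k. torus_action B b (l k) v) \<longlonglongrightarrow> 0"
  proof (rule vec_tendstoI)
    fix j
    show "(\<lambda>k. torus_action B b (l k) v $ j) \<longlonglongrightarrow> 0 $ j"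
    proof (cases "v $ j = 0")
      case False
      have "(\<lambda>k. exp (- \<delta> j) ^ k) \<longlonglongrightarrow> 0"
        using \<delta>[OF False] by (intro LIMSEQ_power_zero) simp
      then have "(\<lambda>k. exp (- (real k * \<delta> j))) \<longlonglongrightarrow> 0"
        by (simp add: exp_of_nat_mult[symmetric])
      then have "(\<lambda>k. of_real (exp (- (real k * \<delta> j))) * v $ j) \<longlonglongrightarrow> of_real 0 * v $ j"
        by (intro tendsto_intros)
      then show ?thesis by (simp add: act)
    qed (simp add: act)
  qed
  moreover have "torus_action B b (l k) v \<in> torus_orbit B b v" for k
    by (auto simp: torus_orbit_def torus_def l_def)
  ultimately show "v \<in> null_cone B b"
    unfolding null_cone_def closure_sequential
    by (intro CollectI exI[of _ "\<lambda>k. torus_action B b (l k) v"] conjI allI)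
qed

text \<open>The index sets whose hull misses \<open>b\<close> are closed under subsets, and their
  coordinate subspaces cover exactly the null cone. An index may be added to all of them iff it is
  never essential for representing \<open>b\<close>, that is, iff its column avoids the minimal
  face.\<close>

lemma Inter_irreducible_components_of_null_cone:
  fixes B :: "int^'m^'d"
  assumes b: "real_vec b \<in> column_polytope B"
  shows "\<Inter>(irreducible_components_of (subtopology zariski (null_cone B b)))
    = coordinate_subspace {j. column j (real_matrix B) \<notin> minimal_face B b}"
proof -
  let ?x = "\<lambda>j. column j (real_matrix B)"
  let ?U = "{S. real_vec b \<notin> convex hull (?x ` S)}"
  have P: "column_polytope B = convex hull (range ?x)"
    by (simp add: column_polytope_def columns_def full_SetCompr_eq)
  have down: "S \<in> ?U" if "T \<in> ?U" "S \<subseteq> T" for S T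
    using that hull_mono[OF image_mono[OF that(2)], of convex ?x] by auto
  have "null_cone B b = (\<Union>S\<in>?U. coordinate_subspace S)"
    using down by (auto simp: in_null_cone_iff coordinate_subspace_def)
  moreover have "{j. \<forall>S\<in>?U. insert j S \<in> ?U} = {j. ?x j \<notin> minimal_face B b}"
    using positive_weight_iff_essential[of ?x "real_vec b"]
      point_in_minimal_face_iff[of "real_vec b" ?x] b
    by (auto simp: P minimal_face_def)
  moreover have "{} \<in> ?U" by simp
  ultimately show ?thesis
    using Inter_irreducible_components_of_coordinate_arrangement[of ?U] down by presburger
qed

text \<open>Each index has some weights \<open>C j\<close> positive at that index; their average
  represents \<open>b\<close> and is positive everywhere.\<close>

lemma minimal_face_contains_all_iff:
  fixes B :: "int^'m^'d"
  assumes b: "real_vec b \<in> column_polytope B"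
  shows "(\<forall>j. column j (real_matrix B) \<in> minimal_face B b) \<longleftrightarrow>
    (\<exists>c\<in>convex_weights (\<lambda>j. column j (real_matrix B)) (real_vec b). \<forall>j. 0 < c j)"
proof -
  let ?x = "\<lambda>j. column j (real_matrix B)"
  let ?W = "convex_weights ?x (real_vec b)"
  have P: "column_polytope B = convex hull (range ?x)"
    by (simp add: column_polytope_def columns_def full_SetCompr_eq)
  have face: "?x j \<in> minimal_face B b \<longleftrightarrow> (\<exists>c\<in>?W. 0 < c j)" for j
    using point_in_minimal_face_iff[of "real_vec b" ?x j] b by (simp add: P minimal_face_def)
  have "\<exists>c\<in>?W. \<forall>j. 0 < c j" if "\<forall>j. \<exists>c\<in>?W. 0 < c j"
  proof -
    from that obtain C where C: "\<And>j. C j \<in> ?W" "\<And>j. 0 < C j j" by metis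
    define N where "N = real CARD('m)"
    have N: "N > 0" by (simp add: N_def)
    define c where "c k = (\<Sum>j\<in>UNIV. C j k) / N" for k
    have nonneg: "0 \<le> C j k" for j k using C(1)[of j] by (simp add: convex_weights_def)
    have pos: "0 < c k" for k
      unfolding c_def using N C(2)[of k] nonneg
      by (intro divide_pos_pos sum_pos2[of UNIV k]) auto
    have "sum c UNIV = (\<Sum>j\<in>UNIV. sum (C j) UNIV) / N"
      unfolding c_def sum_divide_distrib[symmetric] by (subst sum.swap) simp
    also have "\<dots> = 1" using C(1) N by (simp add: convex_weights_def N_def)
    finally have 1: "sum c UNIV = 1" .
    have "(\<Sum>k\<in>UNIV. c k *\<^sub>R ?x k) = (\<Sum>k\<in>UNIV. \<Sum>j\<in>UNIV. (1 / N) *\<^sub>R (C j k *\<^sub>R ?x k))"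
      by (simp add: c_def sum_divide_distrib scaleR_sum_left)
    also have "\<dots> = (\<Sum>j\<in>UNIV. (1 / N) *\<^sub>R (\<Sum>k\<in>UNIV. C j k *\<^sub>R ?x k))"
      by (subst sum.swap) (simp add: scaleR_sum_right)
    also have "\<dots> = (\<Sum>j\<in>(UNIV :: 'm set). (1 / N) *\<^sub>R real_vec b)"
      using C(1) by (simp add: convex_weights_def)
    also have "\<dots> = real_vec b"
      using N by (simp add: sum_constant_scaleR N_def del: sum_constant)
    finally have "c \<in> ?W" using 1 pos by (simp add: convex_weights_def less_imp_le)
    then show ?thesis using pos by blast
  qed
  then show ?thesis unfolding face by blast
qed

section \<open>Maximum likelihood in logarithmic coordinates\<close>

definition exp_vec :: "real^'m \<Rightarrow> real^'m" where
  "exp_vec \<theta> = (\<chi> j. exp (\<theta> $ j))"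

text \<open>The model after taking logarithms. There the log-likelihood is linear, and normalisation
  is the only nonlinear constraint.\<close>

definition log_parameters :: "int^'m^'d \<Rightarrow> (real^'m) set" where
  "log_parameters A = {\<theta> \<in> row_span A. (\<Sum>j\<in>UNIV. exp (\<theta> $ j)) = 1}"

lemma subspace_row_span: "subspace (row_span A)"
  by (simp add: row_span_def)

lemma log_linear_model_eq: "log_linear_model A = exp_vec ` log_parameters A"
proof
  show "log_linear_model A \<subseteq> exp_vec ` log_parameters A"
  proof
    fix p assume p: "p \<in> log_linear_model A"
    then have pos: "\<And>j. 0 < p $ j" by (simp add: log_linear_model_def)
    then have "p = exp_vec (\<chi> j. ln (p $ j))" by (simp add: exp_vec_def vec_eq_iff)
    moreover have "(\<chi> j. ln (p $ j)) \<in> log_parameters A"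
      using p pos by (simp add: log_linear_model_def log_parameters_def prob_simplex_def)
    ultimately show "p \<in> exp_vec ` log_parameters A" by blast
  qed
  show "exp_vec ` log_parameters A \<subseteq> log_linear_model A"
    by (auto simp: log_linear_model_def log_parameters_def prob_simplex_def exp_vec_def
        less_imp_le vec_lambda_eta)
qed

lemma likelihood_exp_vec:
  "likelihood u (exp_vec \<theta>) = exp (\<theta> \<bullet> (\<chi> j. real (u $ j)))"
  by (simp add: likelihood_def exp_vec_def inner_vec_def exp_sum exp_of_nat2_mult)

lemma ex_MLE_iff_log_parameters:
  "(\<exists>p. is_MLE (log_linear_model A) u p) \<longleftrightarrow>
    (\<exists>\<theta>\<in>log_parameters A. \<forall>\<eta>\<in>log_parameters A.
      \<eta> \<bullet> (\<chi> j. real (u $ j)) \<le> \<theta> \<bullet> (\<chi> j. real (u $ j)))"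
  by (auto simp: is_MLE_def is_arg_max_def log_linear_model_eq likelihood_exp_vec not_less)

text \<open>On the row span, \<open>U\<close> acts like the strictly positive vector
  \<open>n *\<^sub>R q\<close>. Since log-probabilities are nonpositive, a lower bound on the
  objective bounds every coordinate from below, so a superlevel set is compact and the maximum is
  attained.\<close>

lemma ex_log_parameters_max:
  fixes A :: "int^'m^'d" and U q :: "real^'m"
  assumes ones: "(\<chi> j. 1) \<in> row_span A" and n: "0 < (n::real)"
    and q: "\<And>j. 0 < q $ j" and U: "\<And>w. w \<in> row_span A \<Longrightarrow> w \<bullet> U = n * (w \<bullet> q)"
  shows "\<exists>\<theta>\<in>log_parameters A. \<forall>\<eta>\<in>log_parameters A. \<eta> \<bullet> U \<le> \<theta> \<bullet> U"
proof -
  \<comment> \<open>The uniform distribution in logarithmic coordinates; as a multiple of the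
    all-ones vector it lies in the row span and makes the superlevel set \<open>K\<close>
    nonempty.\<close>
  define \<theta>0 :: "real^'m" where "\<theta>0 = ln (1 / real CARD('m)) *\<^sub>R (\<chi> j. 1)"
  have "(\<Sum>j\<in>UNIV. exp (\<theta>0 $ j)) = 1"
    by (simp add: \<theta>0_def)
  moreover have "\<theta>0 \<in> row_span A"
    unfolding \<theta>0_def by (rule subspace_scale[OF subspace_row_span ones])
  ultimately have \<theta>0: "\<theta>0 \<in> log_parameters A"
    by (simp add: log_parameters_def)
  define K where "K = {\<theta> \<in> log_parameters A. \<theta>0 \<bullet> U \<le> \<theta> \<bullet> U}"
  have nonpos: "\<theta> $ j \<le> 0" if "\<theta> \<in> log_parameters A" for \<theta> j
  proof -
    have "exp (\<theta> $ j) \<le> (\<Sum>j\<in>UNIV. exp (\<theta> $ j))"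
      by (intro member_le_sum) auto
    then show ?thesis using that by (simp add: log_parameters_def)
  qed
  have "bounded K"
  proof -
    define L where "L = \<bar>\<theta>0 \<bullet> U\<bar>"
    have "\<bar>\<theta> $ j\<bar> \<le> L / (n * q $ j)" if "\<theta> \<in> K" for \<theta> j
    proof -
      have \<theta>: "\<theta> \<in> log_parameters A" "\<theta>0 \<bullet> U \<le> \<theta> \<bullet> U" using that by (auto simp: K_def)
      \<comment> \<open>The terms for the other coordinates are nonpositive and may be
        dropped.\<close>
      have "\<theta> \<bullet> q \<le> \<theta> $ j * q $ j"
      proof -
        have "\<theta> \<bullet> q = \<theta> $ j * q $ j + (\<Sum>k\<in>UNIV - {j}. \<theta> $ k * q $ k)"
          by (simp add: inner_vec_def sum.remove[of UNIV j])
        moreover have "(\<Sum>k\<in>UNIV - {j}. \<theta> $ k * q $ k) \<le> 0"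
          using nonpos[OF \<theta>(1)] q by (intro sum_nonpos mult_nonpos_nonneg) (auto simp: less_imp_le)
        ultimately show ?thesis by simp
      qed
      then have "n * (\<theta> \<bullet> q) \<le> n * (\<theta> $ j * q $ j)"
        using n by simp
      moreover have "\<theta> \<bullet> U = n * (\<theta> \<bullet> q)"
        using \<theta>(1) U by (simp add: log_parameters_def)
      ultimately have "- L \<le> \<theta> $ j * (n * q $ j)"
        using \<theta>(2) by (simp add: L_def algebra_simps abs_real_def split: if_splits)
      then have "- (\<theta> $ j) \<le> L / (n * q $ j)"
        using n q[of j] by (simp add: pos_le_divide_eq)
      then show ?thesis using nonpos[OF \<theta>(1), of j] by simp
    qed
    then have "norm \<theta> \<le> (\<Sum>j\<in>UNIV. L / (n * q $ j))" if "\<theta> \<in> K" for \<theta>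
      using that by (intro order_trans[OF norm_le_l1_cart] sum_mono) auto
    then show ?thesis unfolding bounded_iff by blast
  qed
  moreover have "closed K"
  proof -
    have "K = row_span A \<inter> {\<theta>. (\<Sum>j\<in>UNIV. exp (\<theta> $ j)) = 1} \<inter> {\<theta>. \<theta>0 \<bullet> U \<le> \<theta> \<bullet> U}"
      by (auto simp: K_def log_parameters_def)
    also have "closed \<dots>"
      by (intro closed_Int closed_subspace subspace_row_span closed_Collect_eq closed_Collect_le
          continuous_intros)
    finally show ?thesis .
  qed
  ultimately have "compact K" by (simp add: compact_eq_bounded_closed)
  moreover have "K \<noteq> {}" using \<theta>0 by (auto simp: K_def)
  moreover have "continuous_on K (\<lambda>\<theta>. \<theta> \<bullet> U)" by (intro continuous_intros)
  ultimately obtain \<theta> where \<theta>: "\<theta> \<in> K" "\<And>\<eta>. \<eta> \<in> K \<Longrightarrow> \<eta> \<bullet> U \<le> \<theta> \<bullet> U"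
    using continuous_attains_sup by (metis (no_types, lifting))
  have "\<eta> \<bullet> U \<le> \<theta> \<bullet> U" if "\<eta> \<in> log_parameters A" for \<eta>
    using that \<theta> by (cases "\<eta> \<in> K") (auto simp: K_def)
  with \<theta>(1) show ?thesis by (auto simp: K_def)
qed

text \<open>First-order condition along the curve through \<open>\<theta>\<close> in direction
  \<open>w\<close>, normalised by subtracting a multiple of the all-ones vector, which stays in the
  row span. The vanishing derivative at 0 says that empirical and model expectations of
  \<open>w\<close> agree up to the sample size.\<close>

lemma log_parameters_max_stationary:
  fixes A :: "int^'m^'d" and U :: "real^'m"
  assumes ones: "(\<chi> j. 1) \<in> row_span A" and \<theta>: "\<theta> \<in> log_parameters A"
    and max: "\<And>\<eta>. \<eta> \<in> log_parameters A \<Longrightarrow> \<eta> \<bullet> U \<le> \<theta> \<bullet> U"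
    and w: "w \<in> row_span A"
  shows "w \<bullet> U = (\<Sum>j\<in>UNIV. U $ j) * (w \<bullet> exp_vec \<theta>)"
proof -
  define Z where "Z t = (\<Sum>j\<in>UNIV. exp (\<theta> $ j + t * w $ j))" for t
  \<comment> \<open>The objective along that curve: subtracting \<open>ln (Z t)\<close> from every
    coordinate costs \<open>ln (Z t)\<close> times the total of \<open>U\<close>.\<close>
  define g where "g t = \<theta> \<bullet> U + t * (w \<bullet> U) - ln (Z t) * (\<Sum>j\<in>UNIV. U $ j)" for t
  have Z: "0 < Z t" for t unfolding Z_def by (intro sum_pos) auto
  have Z0: "Z 0 = 1" using \<theta> by (simp add: Z_def log_parameters_def)
  have "(Z has_real_derivative (\<Sum>j\<in>UNIV. exp (\<theta> $ j) * w $ j)) (at 0)"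
    unfolding Z_def by (auto intro!: derivative_eq_intros)
  then have "(g has_real_derivative w \<bullet> U - (w \<bullet> exp_vec \<theta>) * (\<Sum>j\<in>UNIV. U $ j)) (at 0)"
    unfolding g_def using Z0
    by (auto intro!: derivative_eq_intros simp: inner_vec_def exp_vec_def mult.commute)
  moreover have "g t \<le> g 0" for t
  proof -
    define \<eta> where "\<eta> = \<theta> + t *\<^sub>R w - ln (Z t) *\<^sub>R (\<chi> j. 1)"
    have "\<eta> \<in> row_span A"
      unfolding \<eta>_def using \<theta> w ones subspace_row_span[of A]
      by (auto simp: log_parameters_def intro!: subspace_diff subspace_add subspace_scale)
    moreover have "(\<Sum>j\<in>UNIV. exp (\<eta> $ j)) = (\<Sum>j\<in>UNIV. exp (\<theta> $ j + t * w $ j)) / Z t"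
      using Z[of t] by (simp add: \<eta>_def exp_diff sum_divide_distrib)
    ultimately have "\<eta> \<in> log_parameters A"
      using Z[of t] by (simp add: log_parameters_def Z_def)
    then have "\<eta> \<bullet> U \<le> \<theta> \<bullet> U" by (rule max)
    moreover have "\<eta> \<bullet> U = g t"
      by (simp add: \<eta>_def g_def inner_add_left inner_diff_left) (simp add: inner_vec_def)
    ultimately show ?thesis by (simp add: g_def Z0)
  qed
  ultimately have "w \<bullet> U - (w \<bullet> exp_vec \<theta>) * (\<Sum>j\<in>UNIV. U $ j) = 0"
    by (intro DERIV_local_max[where d = 1]) auto
  then show ?thesis by simp
qed

text \<open>A maximiser supplies \<open>q\<close> by stationarity, and any \<open>q\<close> supplies
  a maximiser by compactness. As \<open>q\<close> itself need not lie in the model, existence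
  becomes a linear condition with positivity.\<close>

lemma ex_MLE_iff:
  fixes A :: "int^'m^'d" and u :: "nat^'m"
  assumes ones: "(\<chi> j. 1) \<in> row_span A" and n: "0 < (\<Sum>j\<in>UNIV. u $ j)"
  shows "(\<exists>p. is_MLE (log_linear_model A) u p) \<longleftrightarrow>
    (\<exists>q :: real^'m. (\<forall>j. 0 < q $ j) \<and> (\<Sum>j\<in>UNIV. q $ j) = 1 \<and>
      (\<forall>w\<in>row_span A. w \<bullet> (\<chi> j. real (u $ j)) = real (\<Sum>j\<in>UNIV. u $ j) * (w \<bullet> q)))"
    (is "_ \<longleftrightarrow> ?R")
  unfolding ex_MLE_iff_log_parameters
proof
  let ?U = "\<chi> j. real (u $ j)"
  assume "\<exists>\<theta>\<in>log_parameters A. \<forall>\<eta>\<in>log_parameters A. \<eta> \<bullet> ?U \<le> \<theta> \<bullet> ?U"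
  then obtain \<theta> where \<theta>: "\<theta> \<in> log_parameters A"
    "\<And>\<eta>. \<eta> \<in> log_parameters A \<Longrightarrow> \<eta> \<bullet> ?U \<le> \<theta> \<bullet> ?U" by blast
  have "\<forall>w\<in>row_span A. w \<bullet> ?U = real (\<Sum>j\<in>UNIV. u $ j) * (w \<bullet> exp_vec \<theta>)"
    using log_parameters_max_stationary[OF ones \<theta>] by simp
  moreover have "\<forall>j. 0 < exp_vec \<theta> $ j" "(\<Sum>j\<in>UNIV. exp_vec \<theta> $ j) = 1"
    using \<theta>(1) by (simp_all add: exp_vec_def log_parameters_def)
  ultimately show ?R by blast
next
  assume ?R
  then show "\<exists>\<theta>\<in>log_parameters A. \<forall>\<eta>\<in>log_parameters A.
      \<eta> \<bullet> (\<chi> j. real (u $ j)) \<le> \<theta> \<bullet> (\<chi> j. real (u $ j))"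
    using ex_log_parameters_max[OF ones] n by (metis of_nat_0_less_iff)
qed

section \<open>The null cone for \<open>nA\<close> and \<open>b\<close> compared with existence of
  the MLE\<close>

theorem proposition4p5:
  fixes A nA :: "int^'m^'d" and u :: "nat^'m" and n :: nat and b :: "int^'d"
  assumes "n = (\<Sum>j\<in>UNIV. u $ j)" and "n \<ge> 1"
    and "nA = map_matrix (\<lambda>a. int n * a) A"
    and "b = A *v (\<chi> j. int (u $ j))"
  shows "\<Inter>(irreducible_components_of (subtopology zariski (null_cone nA b)))
      = vec.span {axis j (1::complex) | j. column j (real_matrix nA) \<notin> minimal_face nA b}
    \<and> ((\<chi> j. 1) \<in> row_span A \<longrightarrow>
        ((\<exists>p. is_MLE (log_linear_model A) u p) \<longleftrightarrow>
          \<Inter>(irreducible_components_of (subtopology zariski (null_cone nA b))) = {0}))"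
proof (intro conjI impI)
  let ?x = "\<lambda>j. column j (real_matrix nA)"
  let ?U = "\<chi> j. real (u $ j)"
  have x: "?x j $ i = real n * real_of_int (A $ i $ j)" for i j
    by (simp add: assms(3) map_matrix_def)
  have b: "real_vec b $ i = (\<Sum>j\<in>UNIV. real_of_int (A $ i $ j) * real (u $ j))" for i
    by (simp add: assms(4) matrix_vector_mult_def)
  have "(\<Sum>j\<in>UNIV. real (u $ j)) = real n"
    by (simp add: assms(1))
  \<comment> \<open>The relative frequencies are weights for \<open>b\<close>: the factor
    \<open>n\<close> in the columns of \<open>nA\<close> cancels the division by
    \<open>n\<close>.\<close>
  then have "(\<lambda>j. real (u $ j) / real n) \<in> convex_weights ?x (real_vec b)"
    using assms(2) unfolding convex_weights_def
    by (simp add: vec_eq_iff x b sum_divide_distrib[symmetric] mult.commute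
        del: real_vec_nth column_real_matrix_nth)
  then have P: "real_vec b \<in> column_polytope nA"
    using convex_hull_range_iff_weights[of "real_vec b" ?x]
    by (auto simp: column_polytope_def columns_def full_SetCompr_eq)
  note I = Inter_irreducible_components_of_null_cone[OF P]
  show "\<Inter>(irreducible_components_of (subtopology zariski (null_cone nA b)))
      = vec.span {axis j (1::complex) | j. ?x j \<notin> minimal_face nA b}"
    unfolding I coordinate_subspace_eq_span by simp
  assume ones: "(\<chi> j. 1) \<in> row_span A"
  have row_U: "row i (real_matrix A) \<bullet> ?U = real_vec b $ i" for i
    unfolding b by (simp add: inner_vec_def row_def real_matrix_def map_matrix_def)
  have row_q: "real n * (row i (real_matrix A) \<bullet> q) = (\<Sum>j\<in>UNIV. q $ j *\<^sub>R ?x j) $ i" for i q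
    unfolding sum_component vector_scaleR_component x
    by (simp add: inner_vec_def row_def real_matrix_def map_matrix_def sum_distrib_left mult_ac)
  \<comment> \<open>The identity says that \<open>?U - real n *\<^sub>R q\<close> is orthogonal to
    \<open>w\<close>, so checking it on the rows suffices; there the two sides are the coordinates
    of \<open>b\<close> and of its representation by \<open>q\<close>.\<close>
  have row: "w \<bullet> ?U = real n * (w \<bullet> q)"
    if q: "(\<Sum>j\<in>UNIV. q $ j *\<^sub>R ?x j) = real_vec b" and w: "w \<in> row_span A" for w q
  proof -
    have "orthogonal (?U - real n *\<^sub>R q) w"
    proof (rule orthogonal_to_span[OF w[unfolded row_span_def]])
      fix r assume "r \<in> rows (real_matrix A)"
      then obtain i where r: "r = row i (real_matrix A)" by (auto simp: rows_def)
      have "row i (real_matrix A) \<bullet> ?U = real n * (row i (real_matrix A) \<bullet> q)"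
        unfolding row_U row_q q ..
      then show "orthogonal (?U - real n *\<^sub>R q) r"
        by (simp add: r orthogonal_def inner_diff_left inner_diff_right inner_commute)
    qed
    then show ?thesis
      by (simp add: orthogonal_def inner_diff_left inner_diff_right inner_commute)
  qed
  have weights: "real_vec b = (\<Sum>j\<in>UNIV. q $ j *\<^sub>R ?x j)"
    if q: "\<And>w. w \<in> row_span A \<Longrightarrow> w \<bullet> ?U = real n * (w \<bullet> q)" for q
  proof -
    have "row i (real_matrix A) \<bullet> ?U = real n * (row i (real_matrix A) \<bullet> q)" for i
      by (intro q) (auto simp: row_span_def rows_def intro!: span_base)
    then show ?thesis
      unfolding row_U row_q vec_eq_iff by (rule allI)
  qed
  \<comment> \<open>This turns the likelihood condition on \<open>q\<close> into a representation of
    \<open>b\<close> by the columns of \<open>nA\<close>, the form in which the minimal face is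
    described.\<close>
  have "(\<forall>w\<in>row_span A. w \<bullet> ?U = real n * (w \<bullet> q))
      \<longleftrightarrow> (\<Sum>j\<in>UNIV. q $ j *\<^sub>R ?x j) = real_vec b" for q
    using row[of q] weights[of q] by auto
  then have "(\<exists>p. is_MLE (log_linear_model A) u p) \<longleftrightarrow>
    (\<exists>q :: real^'m. (\<forall>j. 0 < q $ j) \<and> (\<Sum>j\<in>UNIV. q $ j) = 1
      \<and> (\<Sum>j\<in>UNIV. q $ j *\<^sub>R ?x j) = real_vec b)"
    using ex_MLE_iff[OF ones, of u] assms(1,2) by simp
  also have "\<dots> \<longleftrightarrow> (\<exists>c\<in>convex_weights ?x (real_vec b). \<forall>j. 0 < c j)"
  proof
    assume "\<exists>q :: real^'m. (\<forall>j. 0 < q $ j) \<and> (\<Sum>j\<in>UNIV. q $ j) = 1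
      \<and> (\<Sum>j\<in>UNIV. q $ j *\<^sub>R ?x j) = real_vec b"
    then obtain q :: "real^'m" where "\<forall>j. 0 < q $ j" "(\<Sum>j\<in>UNIV. q $ j) = 1"
      "(\<Sum>j\<in>UNIV. q $ j *\<^sub>R ?x j) = real_vec b" by blast
    then show "\<exists>c\<in>convex_weights ?x (real_vec b). \<forall>j. 0 < c j"
      by (intro bexI[of _ "($) q"]) (auto simp: convex_weights_def less_imp_le)
  next
    assume "\<exists>c\<in>convex_weights ?x (real_vec b). \<forall>j. 0 < c j"
    then obtain c where "c \<in> convex_weights ?x (real_vec b)" "\<forall>j. 0 < c j" by blast
    then show "\<exists>q :: real^'m. (\<forall>j. 0 < q $ j) \<and> (\<Sum>j\<in>UNIV. q $ j) = 1
      \<and> (\<Sum>j\<in>UNIV. q $ j *\<^sub>R ?x j) = real_vec b"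
      by (intro exI[of _ "\<chi> j. c j"]) (simp add: convex_weights_def)
  qed
  also have "\<dots> \<longleftrightarrow> {j. ?x j \<notin> minimal_face nA b} = {}"
    using minimal_face_contains_all_iff[OF P] by blast
  also have "\<dots> \<longleftrightarrow> coordinate_subspace {j. ?x j \<notin> minimal_face nA b} = {0}"
    by (rule coordinate_subspace_eq_0_iff[symmetric])
  finally show "(\<exists>p. is_MLE (log_linear_model A) u p) \<longleftrightarrow>
      \<Inter>(irreducible_components_of (subtopology zariski (null_cone nA b))) = {0}"
    unfolding I .
qed

end
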